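(* Let $r$ be a positive integer. For any $\varepsilon>0$ and any $q\in[1,\infty]$, there exist real matrices $\mathbf{A}$, $\mathbf{B}$, $\mathbf{Z}$ of the same size, with $\mathbf{Z}\neq 0$, such that $\mathrm{rank}(\mathbf{A}) = r$, $\mathbf{B} = \mathbf{A}+\mathbf{Z}$, and $$\|\widehat{\mathbf{A}} - \mathbf{A}\|_q > \left((2^q+1)^{1/q} - \varepsilon\right)\|\mathbf{Z}_{\max(r)}\|_q,$$ where $\widehat{\mathbf{A}}$ is the best rank-$r$ approximation (rank-$r$ truncated singular value decomposition) of $\mathbf{B}$, and for $q=\infty$ the quantity $(2^q+1)^{1/q}$ is read as its limit $2$.
   Context: For $\mathbf{M}\in\mathbb{R}^{m\times n}$ with singular values $\sigma_1(\mathbf{M})\ge\cdots\ge\sigma_{\min(m,n)}(\mathbf{M})\ge 0$, the Schatten-$q$ norm is $\|\mathbf{M}\|_q = \left(\sum_{i=1}^{\min(m,n)} \sigma_i(\mathbf{M})^q\right)^{1/q}$ for $1\le q<\infty$, and $\|\mathbf{M}\|_\infty = \sigma_1(\mathbf{M})$ is the spectral norm. Given a singular value decomposition $\mathbf{M} = \sum_{i}\sigma_i(\mathbf{M})\mathbf{u}_i\mathbf{v}_i^\top$ with decreasing singular values, $\mathbf{M}_{\max(r)} = \sum_{i=1}^r \sigma_i(\mathbf{M})\mathbf{u}_i\mathbf{v}_i^\top$ is the best rank-$r$ approximation of $\mathbf{M}$; in particular $\widehat{\mathbf{A}} = \mathbf{B}_{\max(r)}$. *)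

theory Defs
  imports
    Complex_Main
    "Jordan_Normal_Form.DL_Rank"
    "Jordan_Normal_Form.Char_Poly"
    "HOL-Library.Extended_Real"
begin

text \<open>
  The singular values of an \<open>m \<times> n\<close> matrix in decreasing order: the square roots of the \<open>n\<close>
  eigenvalues of the Gram matrix, counted with multiplicity. Its rank is at most \<open>m\<close>, so
  for \<open>m < n\<close> cutting the list at \<open>min m n\<close> only drops zeros.
\<close>

definition singular_values :: "real mat \<Rightarrow> real list" where
  "singular_values M =
     take (min (dim_row M) (dim_col M))
       (rev (sorted_list_of_multiset
          (image_mset sqrt (proots (char_poly (transpose_mat M * M))))))"

text \<open>Indices start at \<open>0\<close>, so \<open>singular_value M 0\<close> is the largest singular value.\<close>

definition singular_value :: "real mat \<Rightarrow> nat \<Rightarrow> real" where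
  "singular_value M i = nth_default 0 (singular_values M) i"

definition schatten_norm :: "ereal \<Rightarrow> real mat \<Rightarrow> real" where
  "schatten_norm q M =
     (if q = \<infinity> then singular_value M 0
      else (\<Sum>i<min (dim_row M) (dim_col M).
              singular_value M i powr real_of_ereal q) powr (1 / real_of_ereal q))"

definition svd_partial_sum ::
  "real mat \<Rightarrow> (nat \<Rightarrow> real vec) \<Rightarrow> (nat \<Rightarrow> real vec) \<Rightarrow> nat \<Rightarrow> real mat" where
  "svd_partial_sum M u v k =
     mat (dim_row M) (dim_col M) (\<lambda>(a, b). \<Sum>i<k. singular_value M i * u i $ a * v i $ b)"

definition orthonormal_family :: "nat \<Rightarrow> nat \<Rightarrow> (nat \<Rightarrow> real vec) \<Rightarrow> bool" where
  "orthonormal_family d k u \<longleftrightarrow>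
     (\<forall>i<k. u i \<in> carrier_vec d) \<and>
     (\<forall>i<k. \<forall>j<k. u i \<bullet> u j = (if i = j then 1 else 0))"

definition is_svd :: "real mat \<Rightarrow> (nat \<Rightarrow> real vec) \<Rightarrow> (nat \<Rightarrow> real vec) \<Rightarrow> bool" where
  "is_svd M u v \<longleftrightarrow>
     orthonormal_family (dim_row M) (min (dim_row M) (dim_col M)) u \<and>
     orthonormal_family (dim_col M) (min (dim_row M) (dim_col M)) v \<and>
     M = svd_partial_sum M u v (min (dim_row M) (dim_col M))"

text \<open>
  A relation rather than a function, since the truncation depends on the chosen decomposition
  when the \<open>r\<close>-th and the next singular value coincide and are nonzero.
\<close>

definition is_truncated_svd :: "nat \<Rightarrow> real mat \<Rightarrow> real mat \<Rightarrow> bool" where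
  "is_truncated_svd r M T \<longleftrightarrow> (\<exists>u v. is_svd M u v \<and> T = svd_partial_sum M u v r)"

text \<open>At \<open>q = \<infinity>\<close> the value is the limit of \<open>(2^q + 1)^(1/q)\<close>.\<close>

definition schatten_const :: "ereal \<Rightarrow> real" where
  "schatten_const q =
     (if q = \<infinity> then 2
      else (2 powr real_of_ereal q + 1) powr (1 / real_of_ereal q))"

end

theory Submission
  imports Defs
begin

text \<open>
  Diagonal matrices suffice. Let \<open>C\<close> be the constant \<open>(2^q + 1)^(1/q)\<close> (or \<open>2\<close> for \<open>q = \<infinity>\<close>), let
  \<open>s > 1\<close>, and take the \<open>2r \<times> 2r\<close> matrices with two diagonal blocks of size \<open>r\<close>
  \[ A = \mathrm{diag}(0,\, -2I), \qquad Z = \mathrm{diag}(sI,\, I), \qquad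
     B = A + Z = \mathrm{diag}(sI,\, -I). \]
  The perturbation moves the block \<open>-2I\<close>, which carries all of \<open>A\<close>, to \<open>-I\<close>, just below
  the block \<open>sI\<close> in absolute value, which it creates elsewhere. The rank \<open>r\<close> truncation of \<open>B\<close> therefore keeps the wrong
  block: it is \<open>diag(sI, 0)\<close>, so the error is \<open>diag(sI, 2I)\<close>, while the truncation
  of \<open>Z\<close> is also \<open>diag(sI, 0)\<close>. For finite \<open>q\<close> the two norms are
  \<open>r^(1/q) (s^q + 2^q)^(1/q)\<close>, which is at least \<open>r^(1/q) C\<close>, and \<open>r^(1/q) s\<close>; for
  \<open>q = \<infinity>\<close> they are \<open>max s 2\<close>, which is at least \<open>C\<close>, and \<open>s\<close>. It remains to choose \<open>s > 1\<close> with \<open>(C - \<epsilon>) s < C\<close>, and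
  \<open>s = 1 + \<epsilon>/C\<close> works.

  The claim about truncations concerns every singular value decomposition, although the singular
  vectors are far from unique here. Since \<open>s > 1\<close>, there is a gap between the \<open>r\<close>-th and the next
  singular value, and then the truncation is unique. For a diagonal matrix this is elementary
  (\<open>truncated_svd_diag_unique\<close>): each singular vector is an eigenvector of the squared
  matrix, so the gap forces it to be supported in a single block.
\<close>

section \<open>Diagonal matrices: singular values, Schatten norms and rank\<close>

text \<open>The \<open>n \<times> n\<close> diagonal matrix with entries \<open>d 0, \<dots>, d (n - 1)\<close>.\<close>

definition diag :: "nat \<Rightarrow> (nat \<Rightarrow> real) \<Rightarrow> real mat" where
  "diag n d = mat n n (\<lambda>(i, j). if i = j then d i else 0)"

lemma diag_carrier [simp]: "diag n d \<in> carrier_mat n n"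
  by (simp add: diag_def)

lemma dim_diag [simp]: "dim_row (diag n d) = n" "dim_col (diag n d) = n"
  by (simp_all add: diag_def)

lemma index_diag [simp]: "i < n \<Longrightarrow> j < n \<Longrightarrow> diag n d $$ (i, j) = (if i = j then d i else 0)"
  by (simp add: diag_def)

lemma diag_add: "diag n d + diag n e = diag n (\<lambda>i. d i + e i)"
  by (rule eq_matI) auto

lemma diag_minus: "diag n d - diag n e = diag n (\<lambda>i. d i - e i)"
  by (rule eq_matI) auto

lemma diag_cong: "(\<And>i. i < n \<Longrightarrow> d i = e i) \<Longrightarrow> diag n d = diag n e"
  by (rule eq_matI) auto

lemma transpose_mult_diag:
  "transpose_mat (diag n d) * diag n d = diag n (\<lambda>i. (d i)\<^sup>2)"
proof (rule eq_matI)
  fix i j assume ij: "i < dim_row (diag n (\<lambda>i. (d i)\<^sup>2))" "j < dim_col (diag n (\<lambda>i. (d i)\<^sup>2))"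
  have "(\<Sum>k = 0..<n. diag n d $$ (k, i) * diag n d $$ (k, j))
      = (\<Sum>k = 0..<n. if k = i then (if i = j then (d i)\<^sup>2 else 0) else 0)"
    using ij by (intro sum.cong) (auto simp: power2_eq_square)
  then show "(transpose_mat (diag n d) * diag n d) $$ (i, j) = diag n (\<lambda>i. (d i)\<^sup>2) $$ (i, j)"
    using ij by (simp add: scalar_prod_def)
qed auto

lemma proots_char_poly_diag:
  "proots (char_poly (diag n d)) = mset (map d [0..<n])"
proof -
  have "upper_triangular (diag n d)"
    by auto
  then have "char_poly (diag n d) = (\<Prod>a\<leftarrow>diag_mat (diag n d). [:- a, 1:])"
    by (rule char_poly_upper_triangular[OF diag_carrier])
  moreover have "diag_mat (diag n d) = map d [0..<n]"
    by (simp add: diag_mat_def)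
  moreover have "proots (\<Prod>a\<leftarrow>xs. [:- a, 1:]) = mset xs" for xs :: "real list"
  proof (induction xs)
    case (Cons a xs)
    have "(\<Prod>a\<leftarrow>xs. [:- a, 1:]) \<noteq> 0" by (auto simp: prod_list_zero_iff)
    then have "proots ([:- a, 1:] * (\<Prod>a\<leftarrow>xs. [:- a, 1:]))
        = proots [:- a, 1:] + proots (\<Prod>a\<leftarrow>xs. [:- a, 1:])"
      by (intro proots_mult) auto
    then show ?case by (simp add: Cons.IH del: mult_pCons_left)
  qed simp
  ultimately show ?thesis by (simp only:)
qed

lemma singular_values_diag:
  "singular_values (diag n d) = rev (sort (map (\<lambda>i. \<bar>d i\<bar>) [0..<n]))"
proof -
  have "image_mset sqrt (proots (char_poly (transpose_mat (diag n d) * diag n d)))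
      = mset (map sqrt (map (\<lambda>i. (d i)\<^sup>2) [0..<n]))"
    by (simp only: transpose_mult_diag proots_char_poly_diag mset_map)
  also have "map sqrt (map (\<lambda>i. (d i)\<^sup>2) [0..<n]) = map (\<lambda>i. \<bar>d i\<bar>) [0..<n]"
    by simp
  finally show ?thesis
    by (simp add: singular_values_def del: mset_map)
qed

text \<open>
  When the absolute values on the diagonal already decrease, no sorting is needed and the
  singular values are matched with the positions on the diagonal.
\<close>

lemma singular_value_diag_antimono:
  assumes "\<And>i j. i \<le> j \<Longrightarrow> j < n \<Longrightarrow> \<bar>d j\<bar> \<le> \<bar>d i\<bar>" and "i < n"
  shows "singular_value (diag n d) i = \<bar>d i\<bar>"
proof -
  have "sorted (rev (map (\<lambda>i. \<bar>d i\<bar>) [0..<n]))"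
    using assms(1) by (simp add: sorted_rev_iff_nth_mono)
  then have "sort (map (\<lambda>i. \<bar>d i\<bar>) [0..<n]) = rev (map (\<lambda>i. \<bar>d i\<bar>) [0..<n])"
    by (intro properties_for_sort) auto
  then show ?thesis
    using assms(2) by (simp add: singular_value_def singular_values_diag nth_default_def)
qed

lemma schatten_norm_diag:
  assumes "q \<noteq> \<infinity>"
  shows "schatten_norm q (diag n d)
       = (\<Sum>i<n. \<bar>d i\<bar> powr real_of_ereal q) powr (1 / real_of_ereal q)"
proof -
  let ?p = "\<lambda>x::real. x powr real_of_ereal q"
  let ?s = "singular_values (diag n d)"
  have len: "length ?s = n" by (simp add: singular_values_diag)
  have "(\<Sum>i<n. ?p (singular_value (diag n d) i)) = sum_list (map ?p ?s)"
    using len by (simp add: sum_list_sum_nth singular_value_def nth_default_def atLeast0LessThan)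
  also have "\<dots> = sum_mset (image_mset ?p (mset ?s))"
    by (simp flip: sum_mset_sum_list)
  also have "mset ?s = mset (map (\<lambda>i. \<bar>d i\<bar>) [0..<n])"
    by (simp add: singular_values_diag)
  also have "sum_mset (image_mset ?p \<dots>) = (\<Sum>i<n. ?p \<bar>d i\<bar>)"
    by (simp flip: mset_map add: sum_mset_sum_list o_def sum_list_sum_nth atLeast0LessThan)
  finally show ?thesis using assms by (simp add: schatten_norm_def)
qed

lemma schatten_norm_infinity_diag:
  assumes "0 < n"
  shows "schatten_norm \<infinity> (diag n d) = Max ((\<lambda>i. \<bar>d i\<bar>) ` {..<n})"
proof -
  let ?xs = "sort (map (\<lambda>i. \<bar>d i\<bar>) [0..<n])"
  have ne: "?xs \<noteq> []" using assms by (simp flip: length_greater_0_conv)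
  have "schatten_norm \<infinity> (diag n d) = last ?xs"
    using ne by (simp add: schatten_norm_def singular_value_def singular_values_diag
        nth_default_def assms hd_rev flip: hd_conv_nth)
  also have "\<dots> = Max (set ?xs)"
  proof (rule Max_eqI[symmetric])
    fix x assume "x \<in> set ?xs"
    then obtain i where "i < length ?xs" "x = ?xs ! i" by (metis in_set_conv_nth)
    then have "x \<le> ?xs ! (length ?xs - 1)" by (simp only:) (rule sorted_nth_mono, auto)
    then show "x \<le> last ?xs" using ne by (metis last_conv_nth)
  next
    show "last ?xs \<in> set ?xs" using ne by (rule last_in_set)
  qed simp
  finally show ?thesis by (simp add: atLeast0LessThan)
qed

lemma rank_diag: "vec_space.rank n (diag n d) = card {i. i < n \<and> d i \<noteq> 0}"
proof -
  interpret vec_space "TYPE(real)" n .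
  define I where "I = {i. i < n \<and> d i \<noteq> 0}"
  have colI: "col (diag n d) i $ j = (if j = i then d i else 0)" if "i < n" "j < n" for i j
    using that by auto
  let ?S = "col (diag n d) ` I"
  have inj: "inj_on (col (diag n d)) I"
  proof (rule inj_onI)
    fix i j assume "i \<in> I" "j \<in> I" "col (diag n d) i = col (diag n d) j"
    then show "i = j" using colI[of i i] colI[of j i] by (auto simp: I_def split: if_splits)
  qed
  have S: "?S \<subseteq> carrier_vec n" "finite ?S" by (auto simp: I_def)
  \<comment> \<open>The columns with nonzero diagonal entry are independent, because the coordinate \<open>j\<close> of a
    combination involves only the \<open>j\<close>-th column. The other columns are zero, so this set is
    maximal.\<close>
  have indpt: "lin_indpt ?S"
  proof (rule finite_lin_indpt2[OF S(2)])
    show "?S \<subseteq> carrier_vec n" by (fact S(1))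
    fix a assume 0: "lincomb a ?S = 0\<^sub>v n"
    show "\<forall>v\<in>?S. a v = 0"
    proof
      fix v assume "v \<in> ?S"
      then obtain j where j: "j \<in> I" "v = col (diag n d) j" by blast
      have "0 = lincomb a ?S $ j" using 0 j by (simp add: I_def)
      also have "\<dots> = (\<Sum>x\<in>?S. a x * x $ j)"
        using j S by (intro lincomb_index) (auto simp: I_def)
      also have "\<dots> = (\<Sum>i\<in>I. a (col (diag n d) i) * col (diag n d) i $ j)"
        by (simp add: sum.reindex[OF inj])
      also have "\<dots> = (\<Sum>i\<in>I. if i = j then a v * d j else 0)"
        using j by (intro sum.cong) (auto simp: colI I_def simp del: index_col)
      also have "\<dots> = a v * d j" using j by (simp add: I_def)
      finally show "a v = 0" using j by (simp add: I_def)
    qed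
  qed
  have "maximal ?S (\<lambda>T. T \<subseteq> set (cols (diag n d)) \<and> lin_indpt T)"
    unfolding maximal_def
  proof (intro conjI allI impI indpt)
    show "?S \<subseteq> set (cols (diag n d))" by (auto simp: cols_def I_def)
    fix T assume T: "?S \<subseteq> T \<and> T \<subseteq> set (cols (diag n d)) \<and> lin_indpt T"
    have "x \<in> ?S" if "x \<in> T" for x
    proof -
      have "x \<in> set (cols (diag n d))" using that T by blast
      then obtain i where i: "i < n" "x = col (diag n d) i" by (auto simp: cols_def)
      have "0\<^sub>v n \<notin> T"
      proof
        assume "0\<^sub>v n \<in> T"
        moreover have "T \<subseteq> carrier_vec n" using T cols_dim[of "diag n d"] by auto
        moreover have "(UNIV :: real set) \<noteq> {0}"
          by (metis UNIV_I singletonD zero_neq_one)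
        ultimately show False using T zero_nin_lin_indpt[of T] by blast
      qed
      then have "x \<noteq> 0\<^sub>v n" using that by blast
      moreover have "x = 0\<^sub>v n" if "d i = 0"
        using that i by (intro eq_vecI) auto
      ultimately show ?thesis using i by (auto simp: I_def)
    qed
    then show "T = ?S" using T by blast
  qed
  from rank_card_indpt[OF diag_carrier this] show ?thesis
    by (simp add: card_image[OF inj]) (simp add: I_def)
qed

section \<open>Truncated singular value decompositions of diagonal matrices\<close>

text \<open>
  The standard basis gives a decomposition once the signs of the diagonal entries are moved into
  the left singular vectors.
\<close>

lemma ex_truncated_svd_diag:
  assumes "\<And>i j. i \<le> j \<Longrightarrow> j < n \<Longrightarrow> \<bar>d j\<bar> \<le> \<bar>d i\<bar>"
  shows "\<exists>T. is_truncated_svd k (diag n d) T"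
proof -
  \<comment> \<open>Not the sign function, since \<open>s i\<close> must have absolute value \<open>1\<close> also where \<open>d i = 0\<close>.\<close>
  define s :: "nat \<Rightarrow> real" where "s i = (if d i < 0 then -1 else 1)" for i
  let ?u = "\<lambda>i. s i \<cdot>\<^sub>v unit_vec n i" and ?v = "\<lambda>i. unit_vec n i :: real vec"
  have "is_svd (diag n d) ?u ?v"
    unfolding is_svd_def
  proof (intro conjI)
    show "orthonormal_family (dim_row (diag n d)) (min (dim_row (diag n d)) (dim_col (diag n d))) ?u"
      by (auto simp: orthonormal_family_def s_def)
    show "orthonormal_family (dim_col (diag n d)) (min (dim_row (diag n d)) (dim_col (diag n d))) ?v"
      by (auto simp: orthonormal_family_def)
    show "diag n d = svd_partial_sum (diag n d) ?u ?v (min (dim_row (diag n d)) (dim_col (diag n d)))"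
    proof (rule eq_matI)
      fix a b
      assume "a < dim_row (svd_partial_sum (diag n d) ?u ?v (min (dim_row (diag n d)) (dim_col (diag n d))))"
        and "b < dim_col (svd_partial_sum (diag n d) ?u ?v (min (dim_row (diag n d)) (dim_col (diag n d))))"
      then have ab: "a < n" "b < n" by (auto simp: svd_partial_sum_def)
      have "(\<Sum>i<n. singular_value (diag n d) i * ?u i $ a * ?v i $ b)
          = (\<Sum>i<n. if i = a then (if a = b then d a else 0) else 0)"
        using ab by (intro sum.cong)
          (auto simp: singular_value_diag_antimono[OF assms] s_def)
      then show "diag n d $$ (a, b) =
        svd_partial_sum (diag n d) ?u ?v (min (dim_row (diag n d)) (dim_col (diag n d))) $$ (a, b)"
        using ab by (simp add: svd_partial_sum_def)
    qed (auto simp: svd_partial_sum_def)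
  qed
  then show ?thesis unfolding is_truncated_svd_def by blast
qed

text \<open>Orthonormality recovers the \<open>j\<close>-th coefficient of a linear combination of the \<open>v i\<close>.\<close>

lemma orthonormal_sum_collapse:
  assumes "orthonormal_family n m v" and "j < m"
  shows "(\<Sum>b<n. (\<Sum>i<m. c i * v i $ b) * v j $ b) = (c j :: real)"
proof -
  have inner: "(\<Sum>b<n. v i $ b * v j $ b) = (if i = j then 1 else 0)" if "i < m" for i
  proof -
    have "v j \<in> carrier_vec n" and "v i \<bullet> v j = (if i = j then 1 else 0)"
      using assms that unfolding orthonormal_family_def by blast+
    then show ?thesis by (simp add: scalar_prod_def atLeast0LessThan)
  qed
  have "(\<Sum>b<n. (\<Sum>i<m. c i * v i $ b) * v j $ b)
      = (\<Sum>i<m. c i * (\<Sum>b<n. v i $ b * v j $ b))"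
    unfolding sum_distrib_left sum_distrib_right mult.assoc by (rule sum.swap)
  also have "\<dots> = (\<Sum>i<m. if i = j then c j else 0)"
    by (intro sum.cong) (auto simp: inner)
  finally show ?thesis using assms(2) by simp
qed

text \<open>
  The relations \<open>D v\<^sub>j = \<sigma>\<^sub>j u\<^sub>j\<close> and \<open>D\<^sup>T u\<^sub>j = \<sigma>\<^sub>j v\<^sub>j\<close> between the singular vectors of
  \<open>D = diag n d\<close>, read off in coordinate \<open>a\<close>.
\<close>

lemma svd_diag_vectors:
  assumes "is_svd (diag n d) u v" and "j < n" and "a < n"
  shows "d a * v j $ a = singular_value (diag n d) j * u j $ a"
    and "d a * u j $ a = singular_value (diag n d) j * v j $ a"
proof -
  let ?\<sigma> = "singular_value (diag n d)"
  have u: "orthonormal_family n n u" and v: "orthonormal_family n n v"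
    and M: "diag n d = svd_partial_sum (diag n d) u v n"
    using assms(1) by (auto simp: is_svd_def)
  have entry: "(if x = y then d x else 0) = (\<Sum>i<n. ?\<sigma> i * u i $ x * v i $ y)"
    if "x < n" "y < n" for x y
    using arg_cong[OF M, of "\<lambda>X. X $$ (x, y)"] that by (simp add: svd_partial_sum_def)
  have "d a * v j $ a = (\<Sum>b<n. if b = a then d a * v j $ a else 0)"
    using assms by simp
  also have "\<dots> = (\<Sum>b<n. (\<Sum>i<n. (?\<sigma> i * u i $ a) * v i $ b) * v j $ b)"
  proof (intro sum.cong refl)
    fix b assume "b \<in> {..<n}"
    then have "(\<Sum>i<n. (?\<sigma> i * u i $ a) * v i $ b) = (if a = b then d a else 0)"
      using entry[of a b] assms(3) by simp
    then show "(if b = a then d a * v j $ a else 0)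
        = (\<Sum>i<n. (?\<sigma> i * u i $ a) * v i $ b) * v j $ b" by simp
  qed
  also have "\<dots> = ?\<sigma> j * u j $ a"
    using orthonormal_sum_collapse[OF v assms(2)] .
  finally show "d a * v j $ a = ?\<sigma> j * u j $ a" .
  have "d a * u j $ a = (\<Sum>b<n. if b = a then d a * u j $ a else 0)"
    using assms by simp
  also have "\<dots> = (\<Sum>b<n. (\<Sum>i<n. (?\<sigma> i * v i $ a) * u i $ b) * u j $ b)"
  proof (intro sum.cong refl)
    fix b assume "b \<in> {..<n}"
    moreover have "(\<Sum>i<n. (?\<sigma> i * v i $ a) * u i $ b) = (\<Sum>i<n. ?\<sigma> i * u i $ b * v i $ a)"
      by (intro sum.cong) simp_all
    ultimately have "(\<Sum>i<n. (?\<sigma> i * v i $ a) * u i $ b) = (if b = a then d b else 0)"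
      using entry[of b a] assms(3) by simp
    then show "(if b = a then d a * u j $ a else 0)
        = (\<Sum>i<n. (?\<sigma> i * v i $ a) * u i $ b) * u j $ b" by simp
  qed
  also have "\<dots> = ?\<sigma> j * v j $ a"
    using orthonormal_sum_collapse[OF u assms(2)] .
  finally show "d a * u j $ a = ?\<sigma> j * v j $ a" .
qed

text \<open>
  If the first \<open>k\<close> diagonal entries are strictly larger in absolute value than the others, then
  every truncation at \<open>k\<close> is the upper left \<open>k \<times> k\<close> block padded with zeros, whichever
  decomposition is used.
\<close>

lemma truncated_svd_diag_unique:
  assumes anti: "\<And>i j. i \<le> j \<Longrightarrow> j < n \<Longrightarrow> \<bar>d j\<bar> \<le> \<bar>d i\<bar>"
    and gap: "\<And>i j. i < k \<Longrightarrow> k \<le> j \<Longrightarrow> j < n \<Longrightarrow> \<bar>d j\<bar> < \<bar>d i\<bar>"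
    and "k \<le> n" and T: "is_truncated_svd k (diag n d) T"
  shows "T = diag n (\<lambda>i. if i < k then d i else 0)"
proof -
  let ?\<sigma> = "singular_value (diag n d)"
  obtain u v where svd: "is_svd (diag n d) u v" and T: "T = svd_partial_sum (diag n d) u v k"
    using T by (auto simp: is_truncated_svd_def)
  have \<sigma>: "?\<sigma> i = \<bar>d i\<bar>" if "i < n" for i
    using singular_value_diag_antimono[OF anti that] .
  \<comment> \<open>Composing the two relations gives \<open>d\<^sub>a\<^sup>2 u\<^sub>i(a) = \<sigma>\<^sub>i\<^sup>2 u\<^sub>i(a)\<close>, so \<open>u\<^sub>i\<close> vanishes at all positions
    on the other side of the gap.\<close>
  have supp: "u i $ a = 0" if "i < n" "a < n" "(i < k) \<noteq> (a < k)" for i a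
  proof -
    have "(d a)\<^sup>2 * u i $ a = d a * (d a * u i $ a)"
      by (simp add: power2_eq_square)
    also have "\<dots> = ?\<sigma> i * (d a * v i $ a)"
      using svd_diag_vectors(2)[OF svd that(1,2)] by simp
    also have "\<dots> = (?\<sigma> i)\<^sup>2 * u i $ a"
      using svd_diag_vectors(1)[OF svd that(1,2)] by (simp add: power2_eq_square)
    finally have "((d a)\<^sup>2 - (d i)\<^sup>2) * u i $ a = 0"
      by (simp add: \<sigma>[OF that(1)] left_diff_distrib)
    moreover have "\<bar>d a\<bar> \<noteq> \<bar>d i\<bar>"
      using gap[of i a] gap[of a i] that by (cases "i < k") auto
    then have "(d a)\<^sup>2 \<noteq> (d i)\<^sup>2" by (auto simp: power2_eq_iff)
    ultimately show ?thesis by simp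
  qed
  show ?thesis
  proof (rule eq_matI)
    fix a b assume "a < dim_row (diag n (\<lambda>i. if i < k then d i else 0))"
      and "b < dim_col (diag n (\<lambda>i. if i < k then d i else 0))"
    then have ab: "a < n" "b < n" by auto
    \<comment> \<open>In row \<open>a < k\<close> the discarded terms \<open>i \<ge> k\<close> vanish, so the truncation agrees with the full
      sum. In the remaining rows the retained terms vanish.\<close>
    show "T $$ (a, b) = diag n (\<lambda>i. if i < k then d i else 0) $$ (a, b)"
    proof (cases "a < k")
      case True
      have "T $$ (a, b) = (\<Sum>i<k. ?\<sigma> i * u i $ a * v i $ b)"
        using ab by (simp add: T svd_partial_sum_def)
      also have "\<dots> = (\<Sum>i<n. ?\<sigma> i * u i $ a * v i $ b)"
        using True ab supp \<open>k \<le> n\<close> by (intro sum.mono_neutral_left) auto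
      also have "\<dots> = svd_partial_sum (diag n d) u v n $$ (a, b)"
        using ab by (simp add: svd_partial_sum_def)
      also have "\<dots> = diag n d $$ (a, b)"
        using svd by (simp add: is_svd_def)
      finally show ?thesis using True ab by simp
    next
      case False
      then have "(\<Sum>i<k. ?\<sigma> i * u i $ a * v i $ b) = 0"
        using ab supp \<open>k \<le> n\<close> by (intro sum.neutral) auto
      then show ?thesis using False ab by (simp add: T svd_partial_sum_def)
    qed
  qed (auto simp: T svd_partial_sum_def)
qed

section \<open>Norms of two-block matrices and the extremal example\<close>

lemma schatten_norm_two_block:
  fixes x y :: real
  assumes "0 < r"
  defines "D \<equiv> diag (2 * r) (\<lambda>i. if i < r then x else y)"
  shows "schatten_norm \<infinity> D = max \<bar>x\<bar> \<bar>y\<bar>"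
    and "q \<noteq> \<infinity> \<Longrightarrow> schatten_norm q D
          = real r powr (1 / real_of_ereal q)
            * (\<bar>x\<bar> powr real_of_ereal q + \<bar>y\<bar> powr real_of_ereal q) powr (1 / real_of_ereal q)"
proof -
  let ?d = "\<lambda>i. if i < r then x else y"
  have "(\<lambda>i. \<bar>?d i\<bar>) ` {..<2 * r} = {\<bar>x\<bar>, \<bar>y\<bar>}"
  proof (intro equalityI subsetI)
    fix t assume "t \<in> {\<bar>x\<bar>, \<bar>y\<bar>}"
    then have "t = \<bar>?d 0\<bar> \<or> t = \<bar>?d r\<bar>" using assms(1) by simp
    moreover have "0 \<in> {..<2 * r}" "r \<in> {..<2 * r}" using assms(1) by simp_all
    ultimately show "t \<in> (\<lambda>i. \<bar>?d i\<bar>) ` {..<2 * r}"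
      by (elim disjE) (rule image_eqI, assumption, assumption)+
  qed auto
  then show "schatten_norm \<infinity> D = max \<bar>x\<bar> \<bar>y\<bar>"
    unfolding D_def using assms(1) by (subst schatten_norm_infinity_diag) auto
  assume q: "q \<noteq> \<infinity>"
  let ?p = "real_of_ereal q"
  have "(\<Sum>i<2 * r. \<bar>?d i\<bar> powr ?p)
      = (\<Sum>i\<in>{0..<r}. \<bar>?d i\<bar> powr ?p) + (\<Sum>i\<in>{r..<2 * r}. \<bar>?d i\<bar> powr ?p)"
    unfolding lessThan_atLeast0 by (rule sum.atLeastLessThan_concat[symmetric]) auto
  also have "(\<Sum>i\<in>{0..<r}. \<bar>?d i\<bar> powr ?p) = (\<Sum>i\<in>{0..<r}. \<bar>x\<bar> powr ?p)"
    by (intro sum.cong) auto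
  also have "(\<Sum>i\<in>{r..<2 * r}. \<bar>?d i\<bar> powr ?p) = (\<Sum>i\<in>{r..<2 * r}. \<bar>y\<bar> powr ?p)"
    by (intro sum.cong) auto
  finally have "(\<Sum>i<2 * r. \<bar>?d i\<bar> powr ?p) = real r * (\<bar>x\<bar> powr ?p + \<bar>y\<bar> powr ?p)"
    by (simp add: distrib_left)
  then show "schatten_norm q D = real r powr (1 / ?p) * (\<bar>x\<bar> powr ?p + \<bar>y\<bar> powr ?p) powr (1 / ?p)"
    unfolding D_def using q by (simp add: schatten_norm_diag powr_mult)
qed

text \<open>The comparison of norms for the truncation \<open>diag(xI, 0)\<close> and the error \<open>diag(xI, 2I)\<close>.\<close>

lemma schatten_norm_two_block_bound:
  fixes x \<epsilon> :: real
  assumes "0 < r" and "1 \<le> q" and "1 \<le> x" and "(schatten_const q - \<epsilon>) * x < schatten_const q"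
  shows "(schatten_const q - \<epsilon>) * schatten_norm q (diag (2 * r) (\<lambda>i. if i < r then x else 0))
       < schatten_norm q (diag (2 * r) (\<lambda>i. if i < r then x else 2))"
proof (cases "q = \<infinity>")
  case True
  then show ?thesis
    using assms by (simp add: schatten_norm_two_block schatten_const_def)
next
  case False
  let ?p = "real_of_ereal q" and ?K = "real r powr (1 / real_of_ereal q)"
  have p: "1 \<le> ?p" using assms(2) False by (cases q) auto
  have K: "0 < ?K" using assms(1) by simp
  have C: "schatten_const q = (2 powr ?p + 1) powr (1 / ?p)"
    using False by (simp add: schatten_const_def)
  have "(x powr ?p) powr (1 / ?p) = x"
    using p assms(3) by (simp add: powr_powr)
  then have "(schatten_const q - \<epsilon>) * schatten_norm q (diag (2 * r) (\<lambda>i. if i < r then x else 0))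
      = ?K * ((schatten_const q - \<epsilon>) * x)"
    using assms(1,3) p False by (simp add: schatten_norm_two_block)
  also have "\<dots> < ?K * schatten_const q"
    using K assms(4) by simp
  also have "schatten_const q \<le> (x powr ?p + 2 powr ?p) powr (1 / ?p)"
  proof -
    have "1 \<le> x powr ?p" using assms(3) p by (simp add: ge_one_powr_ge_zero)
    then show ?thesis unfolding C using p by (intro powr_mono2) auto
  qed
  then have "?K * schatten_const q
      \<le> schatten_norm q (diag (2 * r) (\<lambda>i. if i < r then x else 2))"
    using K assms(1,3) False by (simp add: schatten_norm_two_block)
  finally show ?thesis .
qed

theorem theorem3:
  fixes r :: nat and \<epsilon> :: real and q :: ereal
  assumes "0 < r" and "0 < \<epsilon>" and "1 \<le> q"
  shows "\<exists>(m::nat) (n::nat) (A::real mat) (B::real mat) (Z::real mat).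
           A \<in> carrier_mat m n \<and> B \<in> carrier_mat m n \<and> Z \<in> carrier_mat m n \<and>
           Z \<noteq> 0\<^sub>m m n \<and> vec_space.rank m A = r \<and> B = A + Z \<and>
           (\<exists>Ahat. is_truncated_svd r B Ahat) \<and> (\<exists>Zr. is_truncated_svd r Z Zr) \<and>
           (\<forall>Ahat Zr. is_truncated_svd r B Ahat \<and> is_truncated_svd r Z Zr \<longrightarrow>
              schatten_norm q (Ahat - A) > (schatten_const q - \<epsilon>) * schatten_norm q Zr)"
proof -
  let ?C = "schatten_const q" and ?n = "2 * r"
  have "0 < 2 powr real_of_ereal q + 1"
    by (simp add: add_pos_pos)
  then have C: "0 < ?C"
    by (simp add: schatten_const_def)
  define s where "s = 1 + \<epsilon> / ?C"
  have s: "1 < s" using C assms(2) by (simp add: s_def)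
  have "(?C - \<epsilon>) * s = ?C - \<epsilon>\<^sup>2 / ?C"
    using C by (simp add: s_def field_simps power2_eq_square)
  then have Cs: "(?C - \<epsilon>) * s < ?C" using C assms(2) by simp
  define A where "A = diag ?n (\<lambda>i. if i < r then 0 else -2)"
  define B where "B = diag ?n (\<lambda>i. if i < r then s else -1)"
  define Z where "Z = diag ?n (\<lambda>i. if i < r then s else 1)"
  let ?T = "diag ?n (\<lambda>i. if i < r then s else 0)"
  have "{i. i < ?n \<and> (if i < r then 0 else -2 :: real) \<noteq> 0} = {r..<?n}"
    by auto
  then have rank: "vec_space.rank ?n A = r"
    by (simp add: A_def rank_diag)
  have sum: "B = A + Z"
    unfolding A_def B_def Z_def diag_add by (rule diag_cong) simp
  have "Z $$ (0, 0) = s"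
    using assms(1) by (simp add: Z_def)
  then have nonzero: "Z \<noteq> 0\<^sub>m ?n ?n"
    using s assms(1) by auto
  have ex: "\<exists>T. is_truncated_svd r B T" "\<exists>T. is_truncated_svd r Z T"
    unfolding B_def Z_def using s by (intro ex_truncated_svd_diag; simp)+
  have truncB: "T = ?T" if T: "is_truncated_svd r B T" for T
  proof -
    have "T = diag ?n (\<lambda>i. if i < r then if i < r then s else -1 else 0)"
      using T unfolding B_def by (rule truncated_svd_diag_unique[rotated 3]) (use s in auto)
    also have "\<dots> = ?T"
      by (rule diag_cong) simp
    finally show ?thesis .
  qed
  have truncZ: "T = ?T" if T: "is_truncated_svd r Z T" for T
  proof -
    have "T = diag ?n (\<lambda>i. if i < r then if i < r then s else 1 else 0)"
      using T unfolding Z_def by (rule truncated_svd_diag_unique[rotated 3]) (use s in auto)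
    also have "\<dots> = ?T"
      by (rule diag_cong) simp
    finally show ?thesis .
  qed
  have "?T - A = diag ?n (\<lambda>i. if i < r then s else 2)"
    unfolding A_def diag_minus by (rule diag_cong) simp
  then have "(?C - \<epsilon>) * schatten_norm q ?T < schatten_norm q (?T - A)"
    using schatten_norm_two_block_bound[OF assms(1,3) less_imp_le[OF s] Cs] by simp
  then have "(?C - \<epsilon>) * schatten_norm q Zr < schatten_norm q (Ahat - A)"
    if "is_truncated_svd r B Ahat" "is_truncated_svd r Z Zr" for Ahat Zr
    using truncB[OF that(1)] truncZ[OF that(2)] by simp
  moreover have "A \<in> carrier_mat ?n ?n" "B \<in> carrier_mat ?n ?n" "Z \<in> carrier_mat ?n ?n"
    by (simp_all add: A_def B_def Z_def)
  ultimately show ?thesis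
    using rank sum nonzero ex by blast
qed

end
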